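(* Let $\mathcal{H}$ be a real Hilbert space, let $m\ge1$ be an integer, $\mathrm{I}:=\{1,\ldots,m\}$, and let $(\omega_i)_{i\in\mathrm{I}}$ be real numbers in $]0,1]$ with $\sum_{i\in\mathrm{I}}\omega_i=1$. For every $i\in\mathrm{I}$ let $\gamma_i\in[0,1[$, let $G_i:\mathcal{H}\to\mathcal{H}$ be a $\gamma_i$-BAM, and suppose that $\operatorname{Fix}G_i$ is a closed affine subspace of $\mathcal{H}$ with $\bigcap_{j\in\mathrm{I}}\operatorname{Fix}G_j\ne\varnothing$. Let $\mathcal{H}^m$ be the Cartesian product endowed with the weighted inner product $\langle\mathbf{x},\mathbf{y}\rangle=\sum_{i\in\mathrm{I}}\omega_i\langle x_i,y_i\rangle$, let $\mathbf{D}:=\{(x)_{i\in\mathrm{I}}\in\mathcal{H}^m : x\in\mathcal{H}\}$, and set $c_F:=c\big(\mathbf{D},\times_{j\in\mathrm{I}}(\operatorname{par}\operatorname{Fix}G_j)\big)$, the cosine of the Friedrichs angle computed in $\mathcal{H}^m$. Suppose that $\sum_{j\in\mathrm{I}}(\operatorname{par}\operatorname{Fix}G_j)^\perp$ is closed. Set $\mu:=\max_{j\in\mathrm{I}}\gamma_j$ and $\gamma:=\sqrt{\mu^2+(1-\mu^2)\frac{(1+c_F)^2}{4}}$. Then $\operatorname{Fix}\sum_{j\in\mathrm{I}}\omega_jG_j=\bigcap_{j\in\mathrm{I}}\operatorname{Fix}G_j$ is a closed affine subspace of $\mathcal{H}$ and $\sum_{j\in\mathrm{I}}\omega_jG_j$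 is a $\gamma$-BAM. Moreover, $$(\forall x\in\mathcal{H})(\forall k\in\mathbb{N})\quad\Big\|\Big(\sum_{i\in\mathrm{I}}\omega_iG_i\Big)^kx-\mathrm{P}_{\bigcap_{i\in\mathrm{I}}\operatorname{Fix}G_i}x\Big\|\le\gamma^k\big\|x-\mathrm{P}_{\bigcap_{i\in\mathrm{I}}\operatorname{Fix}G_i}x\big\|.$$
   Context: For a nonempty closed convex set $C$ in a Hilbert space, $\mathrm{P}_C$ denotes the metric projection onto $C$. $\operatorname{Fix}G=\{x\in\mathcal{H}: Gx=x\}$. For an affine subspace $U$ (nonempty by convention), $\operatorname{par}U=U-u$ (any $u\in U$) is the linear subspace parallel to $U$. $\mathbb{N}=\{0,1,2,\ldots\}$. Definition (BAM). Let $G:\mathcal{H}\to\mathcal{H}$ and $\gamma\in[0,1[$. $G$ is a best approximation mapping with constant $\gamma$ ($\gamma$-BAM) if (1) $\operatorname{Fix}G$ is a nonempty closed convex subset of $\mathcal{H}$; (2) $\mathrm{P}_{\operatorname{Fix}G}G=\mathrm{P}_{\operatorname{Fix}G}$; (3) $\|Gx-\mathrm{P}_{\operatorname{Fix}G}x\|\le\gamma\|x-\mathrm{P}_{\operatorname{Fix}G}x\|$ for all $x\in\mathcal{H}$. Friedrichs angle: for linear subspaces $U,V$ of a Hilbert space, $c(U,V):=\sup\{|\langle u,v\rangle| : u\in U\cap(U\cap V)^\perp,\ v\in V\cap(U\cap V)^\perp,\ \|u\|\le1,\ \|v\|\le1\}$. *)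

theory Defs
  imports "HOL-Analysis.Analysis"
begin

definition Fix :: "('a \<Rightarrow> 'a) \<Rightarrow> 'a set"
  where "Fix G = {x. G x = x}"

(* The library's closest_point requires heine_borel, i.e. finite dimension. *)
definition metric_proj :: "'a::metric_space set \<Rightarrow> 'a \<Rightarrow> 'a"
  where "metric_proj C x = (THE p. p \<in> C \<and> (\<forall>y\<in>C. dist x p \<le> dist x y))"

definition par :: "'a::real_vector set \<Rightarrow> 'a set"
  where "par U = (\<lambda>x. x - (SOME u. u \<in> U)) ` U"

definition BAM :: "real \<Rightarrow> ('a::real_inner \<Rightarrow> 'a) \<Rightarrow> bool"
  where "BAM \<gamma> G \<longleftrightarrow>
    0 \<le> \<gamma> \<and> \<gamma> < 1 \<and>
    Fix G \<noteq> {} \<and> closed (Fix G) \<and> convex (Fix G) \<and>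
    (\<forall>x. metric_proj (Fix G) (G x) = metric_proj (Fix G) x) \<and>
    (\<forall>x. norm (G x - metric_proj (Fix G) x) \<le> \<gamma> * norm (x - metric_proj (Fix G) x))"

(* The inner product is a parameter, since H^m carries a weighted one that is not
   available through the class real_inner. The ambient space is not needed: orthogonal
   complements occur only intersected with a subspace of it. *)
definition orth_to :: "('v \<Rightarrow> 'v \<Rightarrow> real) \<Rightarrow> 'v \<Rightarrow> 'v set \<Rightarrow> bool"
  where "orth_to ip u W \<longleftrightarrow> (\<forall>w\<in>W. ip u w = 0)"

definition friedrichs_cos :: "('v \<Rightarrow> 'v \<Rightarrow> real) \<Rightarrow> 'v set \<Rightarrow> 'v set \<Rightarrow> real"
  where "friedrichs_cos ip U V =
    Sup {\<bar>ip u v\<bar> | u v.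
      u \<in> U \<and> orth_to ip u (U \<inter> V) \<and>
      v \<in> V \<and> orth_to ip v (U \<inter> V) \<and>
      sqrt (ip u u) \<le> 1 \<and> sqrt (ip v v) \<le> 1}"

(* H^m is the set of functions in {1..m} \<rightarrow>\<^sub>E UNIV (value undefined outside {1..m}). *)
definition weighted_inner ::
    "nat \<Rightarrow> (nat \<Rightarrow> real) \<Rightarrow> (nat \<Rightarrow> 'a::real_inner) \<Rightarrow> (nat \<Rightarrow> 'a) \<Rightarrow> real"
  where "weighted_inner m \<omega> x y = (\<Sum>i\<in>{1..m}. \<omega> i * (x i \<bullet> y i))"

definition diagonal :: "nat \<Rightarrow> (nat \<Rightarrow> 'a) set"
  where "diagonal m = range (\<lambda>x. \<lambda>i\<in>{1..m}. x)"

lemma par_eq: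
  assumes "affine U" "u \<in> U"
  shows "par U = (\<lambda>x. x - u) ` U"
proof -
  have sub: "(\<lambda>x. x - v) ` U \<subseteq> (\<lambda>x. x - w) ` U" if "v \<in> U" "w \<in> U" for v w
  proof (rule image_subsetI)
    fix x assume "x \<in> U"
    then have "x + 1 *\<^sub>R (w - v) \<in> U"
      using mem_affine_3_minus[OF assms(1) \<open>x \<in> U\<close> that(2) that(1), of 1] by simp
    then show "x - v \<in> (\<lambda>x. x - w) ` U"
      by (intro image_eqI[of _ _ "x + 1 *\<^sub>R (w - v)"]) auto
  qed
  have "(SOME u. u \<in> U) \<in> U" using assms(2) by (rule someI)
  then show ?thesis unfolding par_def using sub assms(2) by blast
qed

lemma metric_proj_unique:
  fixes C :: "'a::{real_inner,banach} set"
  assumes "C \<noteq> {}" "closed C" "convex C"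
  shows "\<exists>!p. p \<in> C \<and> (\<forall>y\<in>C. dist x p \<le> dist x y)"
proof -
  define d where "d = infdist x C"
  have d0: "0 \<le> d" by (simp add: d_def infdist_nonneg)
  have dle: "d \<le> dist x y" if "y \<in> C" for y using that by (simp add: d_def infdist_le)
  have key: "(dist y z)\<^sup>2 \<le> 2 * (dist x y)\<^sup>2 + 2 * (dist x z)\<^sup>2 - 4 * d\<^sup>2"
    if "y \<in> C" "z \<in> C" for y z
  proof -
    define w where "w = (1/2) *\<^sub>R y + (1/2) *\<^sub>R z"
    have "w \<in> C" using convexD[OF assms(3) that, of "1/2" "1/2"] by (simp add: w_def)
    then have "d\<^sup>2 \<le> (dist x w)\<^sup>2" using dle d0 by (intro power_mono)
    moreover have "(dist y z)\<^sup>2 + 4 * (dist x w)\<^sup>2 = 2 * (dist x y)\<^sup>2 + 2 * (dist x z)\<^sup>2"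
      unfolding dist_norm power2_norm_eq_inner w_def
      by (simp add: inner_diff_left inner_diff_right inner_add_left inner_add_right
          inner_commute algebra_simps)
    ultimately show ?thesis by linarith
  qed
  have "\<exists>y\<in>C. dist x y < d + inverse (real (Suc n))" for n
  proof -
    have "(INF y\<in>C. dist x y) < d + inverse (real (Suc n))"
      using assms(1) by (simp add: d_def infdist_notempty)
    then show ?thesis
      using cInf_lessD[of "dist x ` C"] assms(1) by auto
  qed
  then obtain y where yC: "\<And>n. y n \<in> C"
    and yd: "\<And>n. dist x (y n) < d + inverse (real (Suc n))" by metis
  have lim: "(\<lambda>n. dist x (y n)) \<longlonglongrightarrow> d"
  proof (rule tendsto_sandwich[of "\<lambda>_. d" _ _ "\<lambda>n. d + inverse (real (Suc n))"])
    show "(\<lambda>n. d + inverse (real (Suc n))) \<longlonglongrightarrow> d"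
      using LIMSEQ_inverse_real_of_nat_add[of d] by simp
    show "\<forall>\<^sub>F n in sequentially. d \<le> dist x (y n)" using dle yC by simp
    show "\<forall>\<^sub>F n in sequentially. dist x (y n) \<le> d + inverse (real (Suc n))"
      by (intro always_eventually allI less_imp_le yd)
  qed simp
  have "Cauchy y"
  proof (rule metric_CauchyI)
    fix e :: real assume e: "0 < e"
    have "(\<lambda>n. (dist x (y n))\<^sup>2) \<longlonglongrightarrow> d\<^sup>2" using lim by (rule tendsto_power)
    then have "\<forall>\<^sub>F n in sequentially. (dist x (y n))\<^sup>2 < d\<^sup>2 + e\<^sup>2 / 4"
      using e by (intro order_tendstoD) auto
    then obtain N where N: "\<And>n. n \<ge> N \<Longrightarrow> (dist x (y n))\<^sup>2 < d\<^sup>2 + e\<^sup>2 / 4"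
      by (auto simp: eventually_sequentially)
    have "dist (y i) (y j) < e" if "i \<ge> N" "j \<ge> N" for i j
    proof -
      have "(dist (y i) (y j))\<^sup>2 < e\<^sup>2"
        using key[OF yC yC, of i j] N[OF that(1)] N[OF that(2)] by linarith
      then show ?thesis using e by (simp add: power_less_imp_less_base)
    qed
    then show "\<exists>N. \<forall>i\<ge>N. \<forall>j\<ge>N. dist (y i) (y j) < e" by blast
  qed
  then obtain p where p: "y \<longlonglongrightarrow> p" using Cauchy_convergent convergent_def by blast
  have pC: "p \<in> C" using closed_sequentially[OF assms(2)] yC p by blast
  have "(\<lambda>n. dist x (y n)) \<longlonglongrightarrow> dist x p" using p by (intro tendsto_intros)
  then have pd: "dist x p = d" using lim LIMSEQ_unique by blast
  show ?thesis
  proof (rule ex1I)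
    show "p \<in> C \<and> (\<forall>y\<in>C. dist x p \<le> dist x y)" using pC pd dle by simp
    fix q assume q: "q \<in> C \<and> (\<forall>y\<in>C. dist x q \<le> dist x y)"
    then have "dist x q = d" using dle pd pC by (metis order_antisym)
    then have "(dist q p)\<^sup>2 \<le> 0" using key[of q p] q pC pd by simp
    then show "q = p" by simp
  qed
qed

end

theory Submission
  imports Defs
begin

text \<open>Write \<open>V\<^sub>i = par (Fix G\<^sub>i)\<close>, \<open>P\<^sub>i\<close> for the projection onto \<open>V\<^sub>i\<close>, and take 0 as the common
  fixed point. Since \<open>G\<^sub>i x - P\<^sub>i x\<close> is orthogonal to \<open>V\<^sub>i\<close>, the BAM inequality gives
  \<open>\<parallel>G\<^sub>i x\<parallel>\<^sup>2 \<le> \<mu>\<^sup>2 \<parallel>x\<parallel>\<^sup>2 + (1 - \<mu>\<^sup>2) \<parallel>P\<^sub>i x\<parallel>\<^sup>2\<close>. Averaging, it remains to bound \<open>\<Sum>\<omega>\<^sub>i \<parallel>P\<^sub>i x\<parallel>\<^sup>2\<close>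
  for \<open>x\<close> orthogonal to \<open>\<Inter>V\<^sub>i\<close>. This is the squared norm in the product space of the projection
  of the diagonal point \<open>(x, \<dots>, x)\<close> onto the product of the \<open>V\<^sub>i\<close>, hence at most \<open>c\<^sub>F\<^sup>2 \<parallel>x\<parallel>\<^sup>2\<close>,
  and \<open>c\<^sub>F \<le> (1 + c\<^sub>F) / 2\<close>. Closedness of \<open>\<Sum>V\<^sub>i\<^sup>\<bottom>\<close> makes this sum equal to \<open>(\<Inter>V\<^sub>i)\<^sup>\<bottom>\<close>; uniform
  boundedness then yields \<open>\<parallel>x\<parallel> \<le> K \<Sum>\<parallel>x - P\<^sub>i x\<parallel>\<close> on it, which forces \<open>c\<^sub>F < 1\<close>.\<close>

section \<open>Metric projections onto affine sets and closed subspaces\<close>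

lemma
  fixes C :: "'a::{real_inner,banach} set"
  assumes "C \<noteq> {}" "closed C" "convex C"
  shows metric_proj_mem: "metric_proj C x \<in> C"
    and metric_proj_le: "y \<in> C \<Longrightarrow> dist x (metric_proj C x) \<le> dist x y"
  using theI'[OF metric_proj_unique[OF assms, of x]] by (auto simp: metric_proj_def)

text \<open>In an affine set one can move from the nearest point \<open>p\<close> along
  \<open>w - p\<close> in both directions, so the first-order variation of the squared distance must
  vanish, not merely have a sign.\<close>

lemma metric_proj_orthogonal:
  fixes C :: "'a::{real_inner,banach} set"
  assumes "C \<noteq> {}" "closed C" "affine C" "y \<in> C" "z \<in> C"
  shows "(x - metric_proj C x) \<bullet> (y - z) = 0"
proof -
  define p where "p = metric_proj C x"
  have C: "C \<noteq> {}" "closed C" "convex C" using assms affine_imp_convex by auto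
  have pC: "p \<in> C" unfolding p_def by (rule metric_proj_mem[OF C])
  have *: "(x - p) \<bullet> (w - p) = 0" if "w \<in> C" for w
  proof -
    define a b where "a = (x - p) \<bullet> (w - p)" and "b = (w - p) \<bullet> (w - p)"
    \<comment> \<open>The quadratic in \<open>t\<close> is minimal at \<open>a / b\<close>; the
      added 1 avoids dividing by zero when \<open>w = p\<close> and still yields a decrease unless
      \<open>a = 0\<close>.\<close>
    define t where "t = a / (b + 1)"
    have b: "b \<ge> 0" by (simp add: b_def)
    have "p + t *\<^sub>R (w - p) \<in> C"
      using mem_affine_3_minus[OF assms(3) pC that pC] by simp
    then have "dist x p \<le> dist x (p + t *\<^sub>R (w - p))"
      unfolding p_def by (rule metric_proj_le[OF C])
    then have "(norm (x - p))\<^sup>2 \<le> (norm (x - p - t *\<^sub>R (w - p)))\<^sup>2"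
      by (simp add: dist_norm diff_diff_add)
    also have "\<dots> = (norm (x - p))\<^sup>2 - 2 * t * a + t\<^sup>2 * b"
      unfolding power2_norm_eq_inner a_def b_def
      by (simp add: inner_diff_left inner_diff_right inner_commute power2_eq_square algebra_simps)
    finally have "2 * t * a \<le> t\<^sup>2 * b" by simp
    moreover have "a = t * (b + 1)" using b by (simp add: t_def)
    ultimately have "t\<^sup>2 * (b + 2) \<le> 0" by (simp add: power2_eq_square algebra_simps)
    then have "t = 0" using b by (simp add: mult_le_0_iff)
    then show ?thesis using b by (simp add: t_def a_def[symmetric])
  qed
  show ?thesis
    using *[OF assms(4)] *[OF assms(5)] unfolding p_def[symmetric]
    by (simp add: inner_diff_right)
qed

text \<open>With orthogonality the squared distance from \<open>x\<close> to \<open>y\<close> splits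
  as that to \<open>p\<close> plus that from \<open>p\<close> to \<open>y\<close>, so
  \<open>p\<close> is nearest.\<close>

lemma metric_proj_eqI:
  fixes C :: "'a::{real_inner,banach} set"
  assumes "closed C" "convex C" "p \<in> C" "\<And>y. y \<in> C \<Longrightarrow> (x - p) \<bullet> (y - p) = 0"
  shows "metric_proj C x = p"
proof -
  have "dist x p \<le> dist x y" if "y \<in> C" for y
  proof -
    have "(norm (x - y))\<^sup>2 = (norm (x - p))\<^sup>2 - 2 * ((x - p) \<bullet> (y - p)) + (norm (y - p))\<^sup>2"
      unfolding power2_norm_eq_inner
      by (simp add: inner_diff_left inner_diff_right inner_commute algebra_simps)
    then have "(norm (x - p))\<^sup>2 \<le> (norm (x - y))\<^sup>2" using assms(4)[OF that] by simp
    then show ?thesis by (simp add: dist_norm)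
  qed
  moreover have "C \<noteq> {}" using assms(3) by blast
  ultimately show ?thesis
    unfolding metric_proj_def
    using metric_proj_unique[of C x] assms(1-3) by (intro the1_equality) auto
qed

lemma norm_add_orthogonal:
  fixes x y :: "'a::real_inner"
  assumes "x \<bullet> y = 0"
  shows "(norm (x + y))\<^sup>2 = (norm x)\<^sup>2 + (norm y)\<^sup>2"
  using assms by (simp add: power2_norm_eq_inner inner_add_left inner_add_right inner_commute)

lemma
  fixes V :: "'a::{real_inner,banach} set"
  assumes "subspace V" "closed V"
  shows subspace_proj_mem: "metric_proj V x \<in> V"
    and subspace_proj_orthogonal: "v \<in> V \<Longrightarrow> (x - metric_proj V x) \<bullet> v = 0"
    and subspace_proj_pythagoras:
      "(norm x)\<^sup>2 = (norm (metric_proj V x))\<^sup>2 + (norm (x - metric_proj V x))\<^sup>2"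
proof -
  have V: "V \<noteq> {}" "affine V" "0 \<in> V"
    using assms subspace_0 subspace_imp_affine by auto
  show mem: "metric_proj V x \<in> V"
    using metric_proj_mem assms V affine_imp_convex by blast
  show orth: "(x - metric_proj V x) \<bullet> v = 0" if "v \<in> V" for v
    using metric_proj_orthogonal[OF V(1) assms(2) V(2) that V(3)] by simp
  show "(norm x)\<^sup>2 = (norm (metric_proj V x))\<^sup>2 + (norm (x - metric_proj V x))\<^sup>2"
    using norm_add_orthogonal[of "metric_proj V x" "x - metric_proj V x"] orth[OF mem]
    by (simp add: inner_commute)
qed

section \<open>Double complements, uniform boundedness and linear regularity\<close>

lemma mem_orthogonal_comp: "x \<in> W\<^sup>\<bottom> \<longleftrightarrow> (\<forall>w\<in>W. x \<bullet> w = 0)"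
  by (auto simp: orthogonal_comp_def orthogonal_def inner_commute)

text \<open>The residual of a point of the double complement is orthogonal to the point and to its
  projection, hence to itself.\<close>

lemma orthogonal_comp_orthogonal_comp_closed:
  fixes V :: "'a::{real_inner,banach} set"
  assumes "subspace V" "closed V"
  shows "V\<^sup>\<bottom>\<^sup>\<bottom> = V"
proof
  show "V\<^sup>\<bottom>\<^sup>\<bottom> \<subseteq> V"
  proof
    fix x assume x: "x \<in> V\<^sup>\<bottom>\<^sup>\<bottom>"
    define n where "n = x - metric_proj V x"
    have "n \<in> V\<^sup>\<bottom>"
      using subspace_proj_orthogonal[OF assms] by (simp add: n_def mem_orthogonal_comp)
    then have "x \<bullet> n = 0" "n \<bullet> metric_proj V x = 0"
      using x subspace_proj_mem[OF assms] by (auto simp: mem_orthogonal_comp)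
    then have "n \<bullet> n = 0" by (simp add: n_def inner_diff_left inner_diff_right inner_commute)
    then have "x = metric_proj V x" by (simp add: n_def)
    then show "x \<in> V" using subspace_proj_mem[OF assms] by metis
  qed
qed (rule orthogonal_comp_subset)

text \<open>Uniform boundedness for the functionals given by the elements of \<open>Z\<close>, by
  Baire category: one of the closed sets \<open>F N\<close> covering the space contains a
  ball.\<close>

lemma weakly_bounded_imp_bounded:
  fixes Z :: "'a::{real_inner,banach} set"
  assumes "\<And>h. \<exists>B. \<forall>z\<in>Z. \<bar>h \<bullet> z\<bar> \<le> B"
  shows "bounded Z"
proof -
  define F where "F N = {h. \<forall>z\<in>Z. \<bar>h \<bullet> z\<bar> \<le> real N}" for N :: nat
  have closed_F: "closed (F N)" for N
  proof -
    have "F N = (\<Inter>z\<in>Z. {h. \<bar>h \<bullet> z\<bar> \<le> real N})" by (auto simp: F_def)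
    moreover have "closed {h. \<bar>h \<bullet> z\<bar> \<le> real N}" for z
      by (intro closed_Collect_le continuous_intros)
    ultimately show ?thesis by auto
  qed
  have "(\<Union>N. F N) = UNIV"
  proof -
    have "\<exists>N. h \<in> F N" for h
    proof -
      obtain B where "\<forall>z\<in>Z. \<bar>h \<bullet> z\<bar> \<le> B" using assms by blast
      moreover obtain N where "B \<le> real N" using real_arch_simple by blast
      ultimately have "h \<in> F N" unfolding F_def by (auto intro: order_trans)
      then show ?thesis ..
    qed
    then show ?thesis by blast
  qed
  moreover have "interior (\<Union>N. F N) = {}" if "\<And>N. interior (F N) = {}"
    using Baire_category_alt[of "euclidean :: 'a topology" "range F"] closed_F that
    by (force simp: completely_metrizable_space_euclidean)
  ultimately have "\<exists>N. interior (F N) \<noteq> {}" by force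
  then obtain N h0 where "h0 \<in> interior (F N)" by blast
  then obtain e where e: "e > 0" "cball h0 e \<subseteq> F N"
    using mem_interior_cball by blast
  have "norm z \<le> 2 * real N / e" if "z \<in> Z" for z
  proof -
    \<comment> \<open>This is the point of the ball furthest in the direction of \<open>z\<close>,
      so pairing it with \<open>z\<close> gains \<open>e * norm z\<close> over \<open>h0\<close>.
      For \<open>z = 0\<close> division by zero makes it \<open>h0\<close>, and the computation
      still holds.\<close>
    define h where "h = h0 + (e / norm z) *\<^sub>R z"
    have "h0 \<in> F N" using e by auto
    moreover have "h \<in> F N"
      using e by (intro subsetD[OF e(2)]) (auto simp: h_def dist_norm)
    ultimately have "\<bar>h0 \<bullet> z\<bar> \<le> N" "\<bar>h \<bullet> z\<bar> \<le> N" using that by (auto simp: F_def)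
    moreover have "h \<bullet> z = h0 \<bullet> z + e * norm z"
      by (simp add: h_def inner_add_left flip: power2_norm_eq_inner)
        (simp add: power2_eq_square)
    ultimately have "e * norm z \<le> 2 * real N" by linarith
    then show ?thesis using e(1) by (simp add: field_simps)
  qed
  then show ?thesis by (auto simp: bounded_iff)
qed

text \<open>The complement of the sum \<open>R\<close> is always the intersection of the
  \<open>V i\<close>. Taking complements once more returns \<open>R\<close> because it is closed;
  this is how the closedness hypothesis enters.\<close>

lemma orthogonal_comp_Inter_eq_sum:
  fixes V :: "'i \<Rightarrow> 'a::{real_inner,banach} set"
  assumes fin: "finite I"
    and V: "\<And>i. i \<in> I \<Longrightarrow> subspace (V i)" "\<And>i. i \<in> I \<Longrightarrow> closed (V i)"
    and cl: "closed (\<Sum>i\<in>I. (V i)\<^sup>\<bottom>)"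
  shows "(\<Inter>i\<in>I. V i)\<^sup>\<bottom> = (\<Sum>i\<in>I. (V i)\<^sup>\<bottom>)"
proof -
  define R where "R = (\<Sum>i\<in>I. (V i)\<^sup>\<bottom>)"
  have R_alt: "R = {\<Sum>i\<in>I. s i |s. \<forall>i\<in>I. s i \<in> (V i)\<^sup>\<bottom>}"
    unfolding R_def by (rule set_sum_alt[OF fin])
  have sub: "subspace R"
    unfolding subspace_def
  proof (intro conjI ballI allI)
    show "0 \<in> R" unfolding R_alt
      by (auto intro!: exI[of _ "\<lambda>_. 0"] subspace_0 subspace_orthogonal_comp)
  next
    fix x y assume "x \<in> R" "y \<in> R"
    then obtain s t where "x = sum s I" "y = sum t I"
      "\<And>i. i \<in> I \<Longrightarrow> s i \<in> (V i)\<^sup>\<bottom>" "\<And>i. i \<in> I \<Longrightarrow> t i \<in> (V i)\<^sup>\<bottom>"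
      unfolding R_alt by blast
    then show "x + y \<in> R" unfolding R_alt
      by (auto intro!: exI[of _ "\<lambda>i. s i + t i"] subspace_add subspace_orthogonal_comp
          simp: sum.distrib)
  next
    fix c x assume "x \<in> R"
    then obtain s where "x = sum s I" "\<And>i. i \<in> I \<Longrightarrow> s i \<in> (V i)\<^sup>\<bottom>"
      unfolding R_alt by blast
    then show "c *\<^sub>R x \<in> R" unfolding R_alt
      by (auto intro!: exI[of _ "\<lambda>i. c *\<^sub>R s i"] subspace_scale subspace_orthogonal_comp
          simp: scaleR_sum_right)
  qed
  have "R\<^sup>\<bottom> = (\<Inter>i\<in>I. V i)"
  proof
    show "R\<^sup>\<bottom> \<subseteq> (\<Inter>i\<in>I. V i)"
    proof (intro subsetI INT_I)
      fix x i assume x: "x \<in> R\<^sup>\<bottom>" and i: "i \<in> I"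
      \<comment> \<open>Each summand lies in \<open>R\<close>, as the family with a single nonzero
        entry shows.\<close>
      have "y \<in> R" if "y \<in> (V i)\<^sup>\<bottom>" for y
        unfolding R_alt using that i fin
        by (auto intro!: exI[of _ "\<lambda>j. if j = i then y else 0"] subspace_0 subspace_orthogonal_comp)
      then have "x \<in> (V i)\<^sup>\<bottom>\<^sup>\<bottom>" using x by (simp add: mem_orthogonal_comp)
      then show "x \<in> V i" using orthogonal_comp_orthogonal_comp_closed V i by metis
    qed
    show "(\<Inter>i\<in>I. V i) \<subseteq> R\<^sup>\<bottom>"
    proof
      fix x assume x: "x \<in> (\<Inter>i\<in>I. V i)"
      have "x \<bullet> sum s I = 0" if "\<forall>i\<in>I. s i \<in> (V i)\<^sup>\<bottom>" for s
        using that x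
        by (auto simp: inner_sum_right mem_orthogonal_comp inner_commute intro!: sum.neutral)
      then show "x \<in> R\<^sup>\<bottom>" unfolding mem_orthogonal_comp R_alt by blast
    qed
  qed
  then show ?thesis
    using orthogonal_comp_orthogonal_comp_closed[OF sub] cl by (metis R_def)
qed

text \<open>Replaces the open mapping theorem for the sum map of the spaces \<open>(V i)\<^sup>\<bottom>\<close>:
  the points of \<open>(\<Inter>i\<in>I. V i)\<^sup>\<bottom>\<close> with total distance at most 1 are weakly bounded.\<close>

lemma linear_regularity:
  fixes V :: "'i \<Rightarrow> 'a::{real_inner,banach} set"
  assumes fin: "finite I"
    and V: "\<And>i. i \<in> I \<Longrightarrow> subspace (V i)" "\<And>i. i \<in> I \<Longrightarrow> closed (V i)"
    and cl: "closed (\<Sum>i\<in>I. (V i)\<^sup>\<bottom>)"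
  obtains K where "K > 0"
    "\<And>x. x \<in> (\<Inter>i\<in>I. V i)\<^sup>\<bottom> \<Longrightarrow> norm x \<le> K * (\<Sum>i\<in>I. norm (x - metric_proj (V i) x))"
proof -
  define W where "W = (\<Inter>i\<in>I. V i)"
  define d where "d x = (\<Sum>i\<in>I. norm (x - metric_proj (V i) x))" for x
  define Z where "Z = {z \<in> W\<^sup>\<bottom>. d z \<le> 1}"
  have W: "subspace W" "closed W"
    unfolding W_def using V by (auto intro: subspace_Inter)
  have "bounded Z"
  proof (rule weakly_bounded_imp_bounded)
    fix h
    \<comment> \<open>Points of \<open>Z\<close> do not see the component of \<open>h\<close> in
      \<open>W\<close>. The rest decomposes along the spaces \<open>(V i)\<^sup>\<bottom>\<close>,
      and the norms of its pieces give a bound independent of \<open>z\<close>.\<close>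
    define r where "r = h - metric_proj W h"
    have "r \<in> W\<^sup>\<bottom>"
      using subspace_proj_orthogonal[OF W] by (simp add: r_def mem_orthogonal_comp)
    also have "W\<^sup>\<bottom> = (\<Sum>i\<in>I. (V i)\<^sup>\<bottom>)"
      unfolding W_def by (rule orthogonal_comp_Inter_eq_sum[OF fin V cl])
    finally obtain s where r: "r = sum s I" and s: "\<And>i. i \<in> I \<Longrightarrow> s i \<in> (V i)\<^sup>\<bottom>"
      unfolding set_sum_alt[OF fin] by blast
    have "\<bar>h \<bullet> z\<bar> \<le> (\<Sum>i\<in>I. norm (s i))" if z: "z \<in> Z" for z
    proof -
      have dz: "norm (z - metric_proj (V i) z) \<le> 1" if "i \<in> I" for i
      proof -
        have "norm (z - metric_proj (V i) z) \<le> d z"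
          unfolding d_def using fin that
          by (intro member_le_sum[of i I "\<lambda>i. norm (z - metric_proj (V i) z)"]) auto
        then show ?thesis using z by (simp add: Z_def)
      qed
      have "z \<bullet> metric_proj W h = 0"
        using z subspace_proj_mem[OF W, of h] by (simp add: Z_def mem_orthogonal_comp)
      then have "h \<bullet> z = r \<bullet> z"
        by (simp add: r_def inner_diff_left inner_commute[of z])
      \<comment> \<open>Since \<open>s i\<close> is orthogonal to \<open>V i\<close>, the projection
        may be subtracted from \<open>z\<close>, leaving residuals of norm at most 1.\<close>
      also have "\<dots> = (\<Sum>i\<in>I. s i \<bullet> (z - metric_proj (V i) z))"
        unfolding r inner_sum_left
        using s subspace_proj_mem[OF V]
        by (intro sum.cong) (auto simp: inner_diff_right mem_orthogonal_comp)
      also have "\<bar>\<dots>\<bar> \<le> (\<Sum>i\<in>I. norm (s i))"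
      proof (rule order_trans[OF sum_abs sum_mono])
        fix i assume i: "i \<in> I"
        show "\<bar>s i \<bullet> (z - metric_proj (V i) z)\<bar> \<le> norm (s i)"
          using Cauchy_Schwarz_ineq2[of "s i" "z - metric_proj (V i) z"]
            mult_left_mono[OF dz[OF i], of "norm (s i)"] by simp
      qed
      finally show ?thesis .
    qed
    then show "\<exists>B. \<forall>z\<in>Z. \<bar>h \<bullet> z\<bar> \<le> B" by blast
  qed
  then obtain K where K: "K > 0" "\<And>z. z \<in> Z \<Longrightarrow> norm z \<le> K"
    using bounded_pos by blast
  have proj_scale: "metric_proj (V i) (c *\<^sub>R x) = c *\<^sub>R metric_proj (V i) x" if "i \<in> I" for i c x
  proof (rule metric_proj_eqI)
    note Vi = V[OF that]
    show "closed (V i)" "convex (V i)" using Vi subspace_imp_convex by auto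
    show "c *\<^sub>R metric_proj (V i) x \<in> V i"
      using subspace_proj_mem[OF Vi] subspace_scale Vi(1) by blast
    then show "(c *\<^sub>R x - c *\<^sub>R metric_proj (V i) x) \<bullet> (y - c *\<^sub>R metric_proj (V i) x) = 0"
      if "y \<in> V i" for y
      using subspace_proj_orthogonal[OF Vi subspace_diff[OF Vi(1) that]]
      by (simp flip: scaleR_diff_right)
  qed
  \<comment> \<open>Homogeneity of \<open>d\<close> turns the bound on \<open>Z\<close> into an
    estimate for every \<open>x\<close> by rescaling.\<close>
  have d_scale: "d (c *\<^sub>R x) = c * d x" if "c \<ge> 0" for c x
  proof -
    have "d (c *\<^sub>R x) = (\<Sum>i\<in>I. c * norm (x - metric_proj (V i) x))"
      unfolding d_def using that
      by (intro sum.cong) (simp_all add: proj_scale flip: scaleR_diff_right)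
    then show ?thesis by (simp add: d_def sum_distrib_left)
  qed
  have "norm x \<le> K * d x" if x: "x \<in> W\<^sup>\<bottom>" for x
  proof -
    have d0: "d x \<ge> 0" by (simp add: d_def sum_nonneg)
    have bound: "c * norm x \<le> K" if "c \<ge> 0" "c * d x \<le> 1" for c
    proof -
      have "c *\<^sub>R x \<in> Z"
        using x that by (simp add: Z_def d_scale mem_orthogonal_comp)
      then show ?thesis using K(2)[of "c *\<^sub>R x"] that by simp
    qed
    show ?thesis
    proof (cases "d x = 0")
      \<comment> \<open>Here every nonnegative multiple of \<open>x\<close> lies in
        \<open>Z\<close>; a nonzero \<open>x\<close> would have a multiple of norm
        \<open>K + 1\<close>.\<close>
      case True
      have "norm x \<le> 0"
      proof (rule ccontr)
        assume "\<not> norm x \<le> 0"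
        then show False
          using bound[of "(K + 1) / norm x"] True K(1) by simp
      qed
      then show ?thesis using True by simp
    next
      case False
      then show ?thesis using bound[of "1 / d x"] d0 by (simp add: field_simps)
    qed
  qed
  then show ?thesis using that K(1) unfolding W_def d_def by blast
qed

text \<open>By Pythagoras an upper bound on the averaged projections is a lower bound on the
  averaged squared distances, which linear regularity supplies. The factor \<open>q\<close> is what
  later separates the Friedrichs cosine from 1.\<close>

lemma sum_norm_proj_le:
  fixes V :: "'i \<Rightarrow> 'a::{real_inner,banach} set" and \<omega> :: "'i \<Rightarrow> real"
  assumes fin: "finite I"
    and V: "\<And>i. i \<in> I \<Longrightarrow> subspace (V i)" "\<And>i. i \<in> I \<Longrightarrow> closed (V i)"
    and cl: "closed (\<Sum>i\<in>I. (V i)\<^sup>\<bottom>)"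
    and w: "\<And>i. i \<in> I \<Longrightarrow> 0 < \<omega> i" "(\<Sum>i\<in>I. \<omega> i) = 1"
  obtains q where "0 \<le> q" "q < 1"
    "\<And>x. x \<in> (\<Inter>i\<in>I. V i)\<^sup>\<bottom> \<Longrightarrow> (\<Sum>i\<in>I. \<omega> i * (norm (metric_proj (V i) x))\<^sup>2) \<le> q * (norm x)\<^sup>2"
proof -
  obtain K where K: "K > 0"
    "\<And>x. x \<in> (\<Inter>i\<in>I. V i)\<^sup>\<bottom> \<Longrightarrow> norm x \<le> K * (\<Sum>i\<in>I. norm (x - metric_proj (V i) x))"
    using linear_regularity[OF fin V cl] by metis
  \<comment> \<open>The sum of \<open>1 / \<omega> i\<close> is the Cauchy-Schwarz price for
    inserting the weights; the added 1 ensures \<open>L \<ge> 1\<close>, so that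
    \<open>1 - 1 / L\<close> is in [0,1[.\<close>
  define L where "L = K\<^sup>2 * (\<Sum>i\<in>I. 1 / \<omega> i) + 1"
  have S0: "(\<Sum>i\<in>I. 1 / \<omega> i) \<ge> 0" using w(1) by (intro sum_nonneg) (simp add: less_imp_le)
  then have L: "L \<ge> 1" by (simp add: L_def)
  show ?thesis
  proof (rule that)
    show "0 \<le> 1 - 1 / L" "1 - 1 / L < 1" using L by auto
    fix x assume x: "x \<in> (\<Inter>i\<in>I. V i)\<^sup>\<bottom>"
    define \<delta> where "\<delta> i = norm (x - metric_proj (V i) x)" for i
    define D where "D = (\<Sum>i\<in>I. \<omega> i * (\<delta> i)\<^sup>2)"
    have D0: "D \<ge> 0" unfolding D_def using w(1) by (intro sum_nonneg) (simp add: less_imp_le)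
    have "(norm x)\<^sup>2 \<le> (K * (\<Sum>i\<in>I. \<delta> i))\<^sup>2"
      using K(2)[OF x] by (intro power_mono) (auto simp: \<delta>_def)
    also have "(\<Sum>i\<in>I. \<delta> i) = (\<Sum>i\<in>I. (1 / sqrt (\<omega> i)) * (sqrt (\<omega> i) * \<delta> i))"
      using w(1) by (intro sum.cong) (auto simp: less_imp_neq[symmetric])
    also have "(K * \<dots>)\<^sup>2 \<le> K\<^sup>2 * ((\<Sum>i\<in>I. (1 / sqrt (\<omega> i))\<^sup>2) * (\<Sum>i\<in>I. (sqrt (\<omega> i) * \<delta> i)\<^sup>2))"
      unfolding power_mult_distrib[of K] by (intro mult_left_mono Cauchy_Schwarz_ineq_sum) auto
    also have "(\<Sum>i\<in>I. (1 / sqrt (\<omega> i))\<^sup>2) = (\<Sum>i\<in>I. 1 / \<omega> i)"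
      using w(1) by (intro sum.cong) (auto simp: power_divide less_imp_le)
    also have "(\<Sum>i\<in>I. (sqrt (\<omega> i) * \<delta> i)\<^sup>2) = D"
      unfolding D_def using w(1) by (intro sum.cong) (auto simp: power_mult_distrib less_imp_le)
    also have "K\<^sup>2 * ((\<Sum>i\<in>I. 1 / \<omega> i) * D) \<le> L * D"
      using D0 by (simp add: L_def algebra_simps)
    finally have le: "(norm x)\<^sup>2 \<le> L * D" .
    have "(norm x)\<^sup>2 = (\<Sum>i\<in>I. \<omega> i * (norm x)\<^sup>2)"
      using w(2) by (simp flip: sum_distrib_right)
    also have "\<dots> = (\<Sum>i\<in>I. \<omega> i * (norm (metric_proj (V i) x))\<^sup>2 + \<omega> i * (\<delta> i)\<^sup>2)"
      using subspace_proj_pythagoras[OF V, of _ x]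
      by (intro sum.cong) (auto simp: \<delta>_def simp flip: distrib_left)
    finally have "(\<Sum>i\<in>I. \<omega> i * (norm (metric_proj (V i) x))\<^sup>2) = (norm x)\<^sup>2 - D"
      by (simp add: sum.distrib D_def)
    moreover have "(norm x)\<^sup>2 / L \<le> D" using le L by (simp add: field_simps)
    ultimately show "(\<Sum>i\<in>I. \<omega> i * (norm (metric_proj (V i) x))\<^sup>2) \<le> (1 - 1 / L) * (norm x)\<^sup>2"
      by (simp add: algebra_simps)
  qed
qed

section \<open>The Friedrichs angle between the diagonal and a product of subspaces\<close>

lemma weighted_inner_restrict:
  "weighted_inner m \<omega> (\<lambda>i\<in>{1..m}. f i) (\<lambda>i\<in>{1..m}. h i) = (\<Sum>i\<in>{1..m}. \<omega> i * (f i \<bullet> h i))"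
  unfolding weighted_inner_def by (intro sum.cong) auto

text \<open>Because the weights sum to 1, sending \<open>x\<close> to its constant tuple preserves
  inner products, and it carries the intersection of the \<open>V i\<close> onto that of the
  diagonal with the product.\<close>

lemma diagonal_orthogonal_iff:
  fixes V :: "nat \<Rightarrow> 'a::real_inner set"
  assumes w: "(\<Sum>i\<in>{1..m}. \<omega> i) = 1"
  shows "u \<in> diagonal m \<and> orth_to (weighted_inner m \<omega>) u (diagonal m \<inter> (\<Pi>\<^sub>E i\<in>{1..m}. V i))
    \<longleftrightarrow> (\<exists>x \<in> (\<Inter>i\<in>{1..m}. V i)\<^sup>\<bottom>. u = (\<lambda>i\<in>{1..m}. x))"
proof -
  have ip: "weighted_inner m \<omega> (\<lambda>i\<in>{1..m}. x) (\<lambda>i\<in>{1..m}. y) = x \<bullet> y" for x y :: 'a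
    unfolding weighted_inner_restrict using w by (simp flip: sum_distrib_right)
  have D: "diagonal m \<inter> (\<Pi>\<^sub>E i\<in>{1..m}. V i) = (\<lambda>x. \<lambda>i\<in>{1..m}. x) ` (\<Inter>i\<in>{1..m}. V i)"
    unfolding diagonal_def by (auto simp: PiE_iff)
  have "orth_to (weighted_inner m \<omega>) (\<lambda>i\<in>{1..m}. x) (diagonal m \<inter> (\<Pi>\<^sub>E i\<in>{1..m}. V i))
      \<longleftrightarrow> x \<in> (\<Inter>i\<in>{1..m}. V i)\<^sup>\<bottom>" for x :: 'a
    unfolding orth_to_def D mem_orthogonal_comp ball_simps(9) ip ..
  then show ?thesis unfolding diagonal_def by blast
qed

text \<open>Cauchy-Schwarz bounds every competitor in the supremum by \<open>sqrt q\<close>, giving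
  \<open>c < 1\<close>. Conversely, testing the supremum with a normalized diagonal point and its
  normalized projection onto the product bounds the averaged projections by
  \<open>c\<close>.\<close>

lemma
  fixes V :: "nat \<Rightarrow> 'a::{real_inner,banach} set" and \<omega> :: "nat \<Rightarrow> real" and m :: nat
  defines "c \<equiv> friedrichs_cos (weighted_inner m \<omega>) (diagonal m) (\<Pi>\<^sub>E i\<in>{1..m}. V i)"
  assumes V: "\<And>i. i \<in> {1..m} \<Longrightarrow> subspace (V i)" "\<And>i. i \<in> {1..m} \<Longrightarrow> closed (V i)"
    and cl: "closed (\<Sum>i\<in>{1..m}. (V i)\<^sup>\<bottom>)"
    and w: "\<And>i. i \<in> {1..m} \<Longrightarrow> 0 < \<omega> i" "(\<Sum>i\<in>{1..m}. \<omega> i) = 1"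
  shows friedrichs_cos_diagonal_nonneg: "0 \<le> c"
    and friedrichs_cos_diagonal_less_1: "c < 1"
    and sum_norm_proj_le_friedrichs_cos:
      "\<And>x. x \<in> (\<Inter>i\<in>{1..m}. V i)\<^sup>\<bottom> \<Longrightarrow>
        (\<Sum>i\<in>{1..m}. \<omega> i * (norm (metric_proj (V i) x))\<^sup>2) \<le> c\<^sup>2 * (norm x)\<^sup>2"
proof -
  define I where "I = {1..m}"
  define W where "W = (\<Inter>i\<in>I. V i)"
  define X where "X = (\<Pi>\<^sub>E i\<in>I. V i)"
  define ip :: "(nat \<Rightarrow> 'a) \<Rightarrow> (nat \<Rightarrow> 'a) \<Rightarrow> real" where "ip = weighted_inner m \<omega>"
  define S where "S = {\<bar>ip u v\<bar> | u v. u \<in> diagonal m \<and> orth_to ip u (diagonal m \<inter> X) \<and>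
      v \<in> X \<and> orth_to ip v (diagonal m \<inter> X) \<and> sqrt (ip u u) \<le> 1 \<and> sqrt (ip v v) \<le> 1}"
  \<comment> \<open>The weighted norm of the tuple of projections of \<open>x\<close>.\<close>
  define s where "s x = sqrt (\<Sum>i\<in>I. \<omega> i * (norm (metric_proj (V i) x))\<^sup>2)" for x
  note V = V[folded I_def] and w = w[folded I_def] and cl = cl[folded I_def]
  have wI: "0 \<le> \<omega> i" if "i \<in> I" for i using w(1)[OF that] by simp
  have c_S: "c = Sup S"
    unfolding c_def friedrichs_cos_def S_def ip_def X_def I_def ..
  have diag: "u \<in> diagonal m \<and> orth_to ip u (diagonal m \<inter> X)
      \<longleftrightarrow> (\<exists>x\<in>W\<^sup>\<bottom>. u = (\<lambda>i\<in>I. x))" for u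
    unfolding ip_def X_def W_def I_def
    by (rule diagonal_orthogonal_iff[OF w(2)[unfolded I_def]])
  have ip_diag: "ip (\<lambda>i\<in>I. x) (\<lambda>i\<in>I. x) = (norm x)\<^sup>2" for x :: 'a
    unfolding ip_def I_def weighted_inner_restrict power2_norm_eq_inner
    using w(2) by (simp add: I_def flip: sum_distrib_right)
  have ip_self: "ip v v = (\<Sum>i\<in>I. \<omega> i * (norm (v i))\<^sup>2)" for v :: "nat \<Rightarrow> 'a"
    unfolding ip_def weighted_inner_def I_def power2_norm_eq_inner ..
  have s2: "(s x)\<^sup>2 = (\<Sum>i\<in>I. \<omega> i * (norm (metric_proj (V i) x))\<^sup>2)" and s0: "s x \<ge> 0" for x
    unfolding s_def using wI by (auto simp: sum_nonneg)
  have ip_proj: "ip (\<lambda>i\<in>I. x) v = (\<Sum>i\<in>I. \<omega> i * (metric_proj (V i) x \<bullet> v i))"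
    if "\<And>i. i \<in> I \<Longrightarrow> v i \<in> V i" for x v
    unfolding ip_def weighted_inner_def I_def[symmetric]
  proof (intro sum.cong refl)
    fix i assume i: "i \<in> I"
    show "\<omega> i * (restrict (\<lambda>i. x) I i \<bullet> v i) = \<omega> i * (metric_proj (V i) x \<bullet> v i)"
      using subspace_proj_orthogonal[OF V(1)[OF i] V(2)[OF i] that[OF i], of x] i
      by (simp add: inner_diff_left)
  qed
  \<comment> \<open>Against tuples in the product, \<open>x\<close> may be replaced by its
    projections, so Cauchy-Schwarz yields \<open>s x\<close> instead of the larger
    \<open>norm x\<close>.\<close>
  have ip_le: "\<bar>ip (\<lambda>i\<in>I. x) v\<bar> \<le> s x * sqrt (ip v v)" if "\<And>i. i \<in> I \<Longrightarrow> v i \<in> V i" for x v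
  proof -
    have "\<bar>ip (\<lambda>i\<in>I. x) v\<bar> \<le> (\<Sum>i\<in>I. \<bar>\<omega> i * (metric_proj (V i) x \<bullet> v i)\<bar>)"
      using ip_proj[of v x] that by (simp add: sum_abs)
    also have "\<dots> \<le> (\<Sum>i\<in>I. \<bar>sqrt (\<omega> i) * norm (metric_proj (V i) x)\<bar> * \<bar>sqrt (\<omega> i) * norm (v i)\<bar>)"
    proof (rule sum_mono)
      fix i assume i: "i \<in> I"
      obtain r where "0 \<le> r" "sqrt (\<omega> i) = r" "\<omega> i = r * r"
        using wI[OF i] by (metis real_sqrt_ge_zero real_sqrt_mult_self abs_of_nonneg)
      moreover have "r * r * \<bar>metric_proj (V i) x \<bullet> v i\<bar>
          \<le> r * r * (norm (metric_proj (V i) x) * norm (v i))"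
        by (intro mult_left_mono Cauchy_Schwarz_ineq2) simp
      ultimately show "\<bar>\<omega> i * (metric_proj (V i) x \<bullet> v i)\<bar>
          \<le> \<bar>sqrt (\<omega> i) * norm (metric_proj (V i) x)\<bar> * \<bar>sqrt (\<omega> i) * norm (v i)\<bar>"
        by (simp add: abs_mult mult_ac)
    qed
    also have "\<dots> \<le> L2_set (\<lambda>i. sqrt (\<omega> i) * norm (metric_proj (V i) x)) I
        * L2_set (\<lambda>i. sqrt (\<omega> i) * norm (v i)) I"
      by (rule L2_set_mult_ineq)
    also have "\<dots> = s x * sqrt (ip v v)"
      unfolding L2_set_def s_def ip_self using wI by (simp add: power_mult_distrib)
    finally show ?thesis .
  qed
  obtain q where q: "0 \<le> q" "q < 1"
    "\<And>x. x \<in> W\<^sup>\<bottom> \<Longrightarrow> (\<Sum>i\<in>I. \<omega> i * (norm (metric_proj (V i) x))\<^sup>2) \<le> q * (norm x)\<^sup>2"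
    using sum_norm_proj_le[OF _ V cl w] unfolding W_def I_def by blast
  have S_le: "t \<le> sqrt q" if t: "t \<in> S" for t
  proof -
    obtain u v where uv: "t = \<bar>ip u v\<bar>" "u \<in> diagonal m" "orth_to ip u (diagonal m \<inter> X)"
      "v \<in> X" "sqrt (ip u u) \<le> 1" "sqrt (ip v v) \<le> 1"
      using t unfolding S_def by blast
    obtain x where x: "x \<in> W\<^sup>\<bottom>" "u = (\<lambda>i\<in>I. x)" using uv diag by blast
    have nx: "norm x \<le> 1" using uv(5) unfolding x(2) ip_diag by simp
    have "s x \<le> sqrt (q * (norm x)\<^sup>2)"
      unfolding s_def using q(3)[OF x(1)] by simp
    also have "\<dots> \<le> sqrt q"
      using nx q(1) by (simp add: mult_left_le power_le_one)
    finally have sx: "s x \<le> sqrt q" .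
    have "t \<le> s x * sqrt (ip v v)"
      unfolding uv(1) x(2) using uv(4) by (intro ip_le) (auto simp: X_def)
    also have "\<dots> \<le> s x" using s0 uv(6) by (simp add: mult_left_le)
    finally show ?thesis using sx by simp
  qed
  then have bdd: "bdd_above S" by (auto simp: bdd_above_def)
  have memS: "\<bar>ip (\<lambda>i\<in>I. x) v\<bar> \<in> S"
    if "x \<in> W\<^sup>\<bottom>" "v \<in> X" "orth_to ip v (diagonal m \<inter> X)" "norm x \<le> 1" "ip v v \<le> 1" for x v
  proof -
    have "(\<lambda>i\<in>I. x) \<in> diagonal m \<and> orth_to ip (\<lambda>i\<in>I. x) (diagonal m \<inter> X)"
      using diag that(1) by blast
    moreover have "sqrt (ip (\<lambda>i\<in>I. x) (\<lambda>i\<in>I. x)) \<le> 1" using that(4) by (simp add: ip_diag)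
    ultimately show ?thesis unfolding S_def using that by auto
  qed
  \<comment> \<open>The zero pair makes \<open>S\<close> nonempty, which together with boundedness
    makes its supremum meaningful, and gives \<open>0 \<le> c\<close>.\<close>
  have "\<bar>ip (\<lambda>i\<in>I. 0) (\<lambda>i\<in>I. 0)\<bar> \<in> S"
  proof (rule memS)
    show "orth_to ip (\<lambda>i\<in>I. 0) (diagonal m \<inter> X)"
      by (auto simp: orth_to_def ip_def weighted_inner_def I_def intro!: sum.neutral)
  qed (use V(1) subspace_0 in \<open>auto simp: mem_orthogonal_comp X_def ip_diag\<close>)
  moreover have "ip (\<lambda>i\<in>I. 0) (\<lambda>i\<in>I. 0) = 0" by (simp add: ip_diag)
  ultimately have S0: "0 \<in> S" by simp
  show c0: "0 \<le> c" unfolding c_S using S0 bdd by (rule cSup_upper)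
  have "c \<le> sqrt q" unfolding c_S using S0 S_le by (intro cSup_least) auto
  also have "\<dots> < 1" using q by simp
  finally show "c < 1" .
  fix x assume "x \<in> (\<Inter>i\<in>{1..m}. V i)\<^sup>\<bottom>"
  then have x: "x \<in> W\<^sup>\<bottom>" unfolding W_def I_def .
  have "s x \<le> c * norm x"
  \<comment> \<open>The degenerate case is split off since the test pair divides by
    \<open>norm x\<close> and \<open>s x\<close>.\<close>
  proof (cases "s x = 0 \<or> x = 0")
    case True
    moreover have "(s 0)\<^sup>2 \<le> q * (norm (0::'a))\<^sup>2"
      unfolding s2 by (rule q(3)) (simp add: mem_orthogonal_comp)
    ultimately show ?thesis using c0 by auto
  next
    case False
    then have pos: "s x > 0" "norm x > 0" using s0[of x] by auto
    define y where "y = (1 / norm x) *\<^sub>R x"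
    define v where "v = (\<lambda>i\<in>I. (1 / s x) *\<^sub>R metric_proj (V i) x)"
    have vV: "v i \<in> V i" if "i \<in> I" for i
      using that subspace_scale[OF V(1)[OF that] subspace_proj_mem[OF V(1)[OF that] V(2)[OF that]]]
      by (simp add: v_def)
    have "\<bar>ip (\<lambda>i\<in>I. y) v\<bar> \<in> S"
    proof (rule memS)
      show "y \<in> W\<^sup>\<bottom>" using x by (simp add: y_def mem_orthogonal_comp)
      show "v \<in> X" unfolding X_def using vV by (auto simp: v_def)
      show "norm y \<le> 1" using pos by (simp add: y_def)
      have "ip v v = (\<Sum>i\<in>I. (1 / s x)\<^sup>2 * (\<omega> i * (norm (metric_proj (V i) x))\<^sup>2))"
        unfolding ip_self
        by (intro sum.cong) (auto simp: v_def power_mult_distrib power_divide)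
      also have "\<dots> = 1"
        unfolding sum_distrib_left[symmetric] s2[symmetric] using pos by (simp add: power_divide)
      finally show "ip v v \<le> 1" by simp
      \<comment> \<open>A constant tuple in the product comes from some \<open>a\<close> in
        \<open>W\<close>, and projecting \<open>x\<close> onto \<open>V i\<close> does not change
        its zero inner product with \<open>a\<close>.\<close>
      show "orth_to ip v (diagonal m \<inter> X)"
        unfolding orth_to_def
      proof
        fix z assume "z \<in> diagonal m \<inter> X"
        then obtain a where a: "z = (\<lambda>i\<in>I. a)" "\<And>i. i \<in> I \<Longrightarrow> a \<in> V i"
          unfolding diagonal_def X_def I_def[symmetric] by (auto simp: PiE_iff)
        have "metric_proj (V i) x \<bullet> a = x \<bullet> a" if "i \<in> I" for i
          using subspace_proj_orthogonal[OF V(1)[OF that] V(2)[OF that] a(2)[OF that], of x]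
          by (simp add: inner_diff_left)
        moreover have "x \<bullet> a = 0" using x a(2) by (simp add: mem_orthogonal_comp W_def)
        ultimately show "ip v z = 0"
          unfolding ip_def v_def a(1) I_def weighted_inner_restrict by (simp add: I_def)
      qed
    qed
    then have "\<bar>ip (\<lambda>i\<in>I. y) v\<bar> \<le> c" unfolding c_S using bdd by (intro cSup_upper)
    moreover have "ip (\<lambda>i\<in>I. y) v = s x / norm x"
    proof -
      have "ip (\<lambda>i\<in>I. y) v = (1 / norm x) * ip (\<lambda>i\<in>I. x) v"
        unfolding ip_def weighted_inner_def I_def[symmetric] sum_distrib_left
        by (intro sum.cong) (auto simp: y_def)
      also have "ip (\<lambda>i\<in>I. x) v = (\<Sum>i\<in>I. (1 / s x) * (\<omega> i * (norm (metric_proj (V i) x))\<^sup>2))"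
        using ip_proj[of v x] vV
        by (auto simp: v_def power2_norm_eq_inner intro!: sum.cong)
      also have "\<dots> = s x"
        unfolding sum_distrib_left[symmetric] s2[symmetric] using pos by (simp add: power2_eq_square)
      also have "1 / norm x * s x = s x / norm x" by simp
      finally show ?thesis .
    qed
    ultimately show ?thesis using pos by (simp add: field_simps)
  qed
  then have "(s x)\<^sup>2 \<le> (c * norm x)\<^sup>2" using s0 by (intro power_mono) auto
  then show "(\<Sum>i\<in>{1..m}. \<omega> i * (norm (metric_proj (V i) x))\<^sup>2) \<le> c\<^sup>2 * (norm x)\<^sup>2"
    unfolding s2 power_mult_distrib I_def .
qed

section \<open>Parallel subspaces and BAMs with affine fixed point sets\<close>

lemma
  fixes A :: "'a::{real_inner,banach} set"
  assumes "affine A" "closed A" "a \<in> A"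
  shows subspace_par: "subspace (par A)"
    and closed_par: "closed (par A)"
    and mem_par_iff: "v \<in> par A \<longleftrightarrow> a + v \<in> A"
    and metric_proj_par: "metric_proj (par A) (x - a) = metric_proj A x - a"
proof -
  have par: "par A = (+) (- a) ` A" using par_eq[OF assms(1,3)] by simp
  show mem: "v \<in> par A \<longleftrightarrow> a + v \<in> A" for v
    unfolding par by (auto intro: image_eqI[of _ _ "a + v"])
  show sub: "subspace (par A)"
    unfolding par by (rule affine_diffs_subspace[OF assms(1,3)])
  show cl: "closed (par A)"
    unfolding par by (rule closed_translation[OF assms(2)])
  have A: "A \<noteq> {}" "convex A" using assms affine_imp_convex by auto
  show "metric_proj (par A) (x - a) = metric_proj A x - a"
  proof (rule metric_proj_eqI)
    show "metric_proj A x - a \<in> par A"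
      using metric_proj_mem[OF A(1) assms(2) A(2)] by (simp add: mem)
    show "(x - a - (metric_proj A x - a)) \<bullet> (y - (metric_proj A x - a)) = 0" if "y \<in> par A" for y
      using metric_proj_orthogonal[OF A(1) assms(2,1), of "a + y" "metric_proj A x" x] that
        metric_proj_mem[OF A(1) assms(2) A(2)]
      by (simp add: mem algebra_simps)
  qed (use cl sub subspace_imp_convex in auto)
qed

text \<open>\<open>G x\<close> and \<open>x\<close> have the same projection onto
  \<open>Fix G\<close>, so both residuals are orthogonal to its directions, and so is their
  difference.\<close>

lemma BAM_affine_orthogonal:
  fixes G :: "'a::{real_inner,banach} \<Rightarrow> 'a"
  assumes "BAM \<gamma> G" "affine (Fix G)" "y \<in> Fix G" "z \<in> Fix G"
  shows "(G x - x) \<bullet> (y - z) = 0"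
proof -
  have F: "Fix G \<noteq> {}" "closed (Fix G)" using assms(1) by (auto simp: BAM_def)
  have "metric_proj (Fix G) (G x) = metric_proj (Fix G) x"
    using assms(1) by (simp add: BAM_def)
  then show ?thesis
    using metric_proj_orthogonal[OF F assms(2-4), of x] metric_proj_orthogonal[OF F assms(2-4), of "G x"]
    by (simp add: inner_diff_left)
qed

text \<open>Pythagoras at the shared projection of \<open>x\<close> and \<open>G x\<close>: only the
  residual is contracted, the part inside \<open>Fix G\<close> is kept. Weakening to a common
  \<open>\<mu>\<close> lets the estimates be averaged.\<close>

lemma BAM_affine_norm_le:
  fixes G :: "'a::{real_inner,banach} \<Rightarrow> 'a"
  assumes "BAM \<gamma> G" "affine (Fix G)" "p \<in> Fix G" "\<gamma> \<le> \<mu>" "\<mu> \<le> 1"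
  shows "(norm (G x - p))\<^sup>2
    \<le> \<mu>\<^sup>2 * (norm (x - p))\<^sup>2 + (1 - \<mu>\<^sup>2) * (norm (metric_proj (Fix G) x - p))\<^sup>2"
proof -
  define P where "P = metric_proj (Fix G)"
  have F: "Fix G \<noteq> {}" "closed (Fix G)" "convex (Fix G)" and \<gamma>: "0 \<le> \<gamma>"
    using assms(1) by (auto simp: BAM_def)
  have P: "P (G x) = P x" and le: "norm (G x - P x) \<le> \<gamma> * norm (x - P x)"
    using assms(1) by (auto simp: BAM_def P_def)
  have orth: "(z - P z) \<bullet> (P z - p) = 0" for z
    unfolding P_def
    by (rule metric_proj_orthogonal[OF F(1,2) assms(2) metric_proj_mem[OF F] assms(3)])
  have split: "(norm (z - p))\<^sup>2 = (norm (z - P z))\<^sup>2 + (norm (P z - p))\<^sup>2" for z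
    using norm_add_orthogonal[OF orth[of z]] by simp
  have "norm (G x - P x) \<le> \<mu> * norm (x - P x)"
    using le assms(4) by (meson mult_right_mono norm_ge_zero order_trans)
  then have "(norm (G x - P x))\<^sup>2 \<le> (\<mu> * norm (x - P x))\<^sup>2" by (intro power_mono) auto
  then show ?thesis
    using split[of x] split[of "G x"] unfolding P P_def[symmetric]
    by (simp add: power_mult_distrib algebra_simps)
qed

text \<open>Jensen's inequality for the squared norm, from Cauchy-Schwarz with each weight split
  into two square roots.\<close>

lemma norm_convex_combination_sq_le:
  fixes a :: "'i \<Rightarrow> 'a::real_normed_vector"
  assumes "\<And>i. i \<in> I \<Longrightarrow> 0 \<le> \<omega> i" "(\<Sum>i\<in>I. \<omega> i) = 1"
  shows "(norm (\<Sum>i\<in>I. \<omega> i *\<^sub>R a i))\<^sup>2 \<le> (\<Sum>i\<in>I. \<omega> i * (norm (a i))\<^sup>2)"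
proof -
  have "norm (\<Sum>i\<in>I. \<omega> i *\<^sub>R a i) \<le> (\<Sum>i\<in>I. \<omega> i * norm (a i))"
    using assms(1) by (intro sum_norm_le) auto
  also have "\<dots> = (\<Sum>i\<in>I. sqrt (\<omega> i) * (sqrt (\<omega> i) * norm (a i)))"
    using assms(1) by (intro sum.cong) (auto simp flip: mult.assoc)
  finally have "(norm (\<Sum>i\<in>I. \<omega> i *\<^sub>R a i))\<^sup>2 \<le> (\<Sum>i\<in>I. sqrt (\<omega> i) * (sqrt (\<omega> i) * norm (a i)))\<^sup>2"
    by (intro power_mono) auto
  also have "\<dots> \<le> (\<Sum>i\<in>I. (sqrt (\<omega> i))\<^sup>2) * (\<Sum>i\<in>I. (sqrt (\<omega> i) * norm (a i))\<^sup>2)"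
    by (rule Cauchy_Schwarz_ineq_sum)
  also have "\<dots> = (\<Sum>i\<in>I. \<omega> i * (norm (a i))\<^sup>2)"
    using assms by (simp add: power_mult_distrib)
  finally show ?thesis .
qed

text \<open>All iterates share the projection of \<open>x\<close>, so the one-step contraction
  always refers to the same target point.\<close>

lemma BAM_funpow_norm_le:
  assumes "BAM \<gamma> G"
  shows "norm ((G ^^ k) x - metric_proj (Fix G) x) \<le> \<gamma> ^ k * norm (x - metric_proj (Fix G) x)"
proof (induction k)
  case (Suc k)
  have P: "metric_proj (Fix G) ((G ^^ k) x) = metric_proj (Fix G) x" for k
    by (induction k) (use assms in \<open>auto simp: BAM_def\<close>)
  have "norm ((G ^^ Suc k) x - metric_proj (Fix G) x) \<le> \<gamma> * norm ((G ^^ k) x - metric_proj (Fix G) x)"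
    using assms P[of k] unfolding BAM_def by (metis funpow.simps(2) o_apply)
  also have "\<dots> \<le> \<gamma> * (\<gamma> ^ k * norm (x - metric_proj (Fix G) x))"
    using Suc assms by (intro mult_left_mono) (auto simp: BAM_def)
  finally show ?case by (simp add: mult.assoc)
qed simp

section \<open>Convex combinations of BAMs\<close>

theorem theorem5p10:
  fixes m :: nat
    and \<omega> g :: "nat \<Rightarrow> real"
    and G :: "nat \<Rightarrow> 'a::{real_inner,banach} \<Rightarrow> 'a"
    and c\<^sub>F \<mu> \<gamma> :: real
    and T :: "'a \<Rightarrow> 'a"
  assumes "m \<ge> 1"
    and "\<And>i. i \<in> {1..m} \<Longrightarrow> 0 < \<omega> i \<and> \<omega> i \<le> 1"
    and "(\<Sum>i\<in>{1..m}. \<omega> i) = 1"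
    and "\<And>i. i \<in> {1..m} \<Longrightarrow> 0 \<le> g i \<and> g i < 1"
    and "\<And>i. i \<in> {1..m} \<Longrightarrow> BAM (g i) (G i)"
    and "\<And>i. i \<in> {1..m} \<Longrightarrow> closed (Fix (G i)) \<and> affine (Fix (G i))"
    and "(\<Inter>j\<in>{1..m}. Fix (G j)) \<noteq> {}"
    and "closed (\<Sum>j\<in>{1..m}. (par (Fix (G j)))\<^sup>\<bottom>)"
  defines "c\<^sub>F \<equiv> friedrichs_cos (weighted_inner m \<omega>)
                  (diagonal m) (\<Pi>\<^sub>E j\<in>{1..m}. par (Fix (G j)))"
    and "\<mu> \<equiv> Max (g ` {1..m})"
    and "\<gamma> \<equiv> sqrt (\<mu>\<^sup>2 + (1 - \<mu>\<^sup>2) * ((1 + c\<^sub>F)\<^sup>2 / 4))"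
    and "T \<equiv> (\<lambda>x. \<Sum>j\<in>{1..m}. \<omega> j *\<^sub>R G j x)"
  shows "Fix T = (\<Inter>j\<in>{1..m}. Fix (G j))
    \<and> (\<Inter>j\<in>{1..m}. Fix (G j)) \<noteq> {}
    \<and> closed (\<Inter>j\<in>{1..m}. Fix (G j))
    \<and> affine (\<Inter>j\<in>{1..m}. Fix (G j))
    \<and> BAM \<gamma> T
    \<and> (\<forall>x. \<forall>k::nat. norm ((T ^^ k) x - metric_proj (\<Inter>j\<in>{1..m}. Fix (G j)) x)
          \<le> \<gamma> ^ k * norm (x - metric_proj (\<Inter>j\<in>{1..m}. Fix (G j)) x))"
proof -
  define F where "F = (\<Inter>j\<in>{1..m}. Fix (G j))"
  define V where "V j = par (Fix (G j))" for j
  define P where "P = metric_proj F"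
  have F: "F \<noteq> {}" "closed F" "affine F" "convex F"
    unfolding F_def using assms(6,7) by (auto intro!: affine_Inter closed_INT convex_INT affine_imp_convex)
  have P_mem: "P x \<in> F" for x unfolding P_def using F by (intro metric_proj_mem)
  have P_mem_Fix: "P x \<in> Fix (G j)" if "j \<in> {1..m}" for x j using P_mem that by (auto simp: F_def)
  note par = subspace_par closed_par mem_par_iff metric_proj_par
  \<comment> \<open>The origin is moved to \<open>P x\<close>, which varies with \<open>x\<close>
    but lies in every \<open>Fix (G j)\<close>; the affine sets then become the subspaces
    \<open>V j\<close>.\<close>
  have Vsub: "subspace (V j)" and Vcl: "closed (V j)"
    and Vproj: "metric_proj (V j) (x - P x) = metric_proj (Fix (G j)) x - P x"
    and Vmem: "v \<in> V j \<longleftrightarrow> P x + v \<in> Fix (G j)"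
    if "j \<in> {1..m}" for j x v
    unfolding V_def using par[OF _ _ P_mem_Fix[OF that]] assms(6)[OF that] by auto
  have w: "0 < \<omega> j" if "j \<in> {1..m}" for j using assms(2)[OF that] by simp
  note friedrichs = Vsub Vcl assms(8)[folded V_def] w assms(3)
  have c: "0 \<le> c\<^sub>F" "c\<^sub>F < 1"
    unfolding c\<^sub>F_def V_def[symmetric]
    by (rule friedrichs_cos_diagonal_nonneg[OF friedrichs] friedrichs_cos_diagonal_less_1[OF friedrichs];
        assumption)+
  have sum_proj_le: "(\<Sum>i\<in>{1..m}. \<omega> i * (norm (metric_proj (V i) x))\<^sup>2) \<le> c\<^sub>F\<^sup>2 * (norm x)\<^sup>2"
    if "x \<in> (\<Inter>i\<in>{1..m}. V i)\<^sup>\<bottom>" for x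
    unfolding c\<^sub>F_def V_def[symmetric]
    by (rule sum_norm_proj_le_friedrichs_cos[OF friedrichs that]; assumption)
  have "\<mu> \<in> g ` {1..m}" unfolding \<mu>_def using assms(1) by (intro Max_in) auto
  then have \<mu>: "0 \<le> \<mu>" "\<mu> < 1" using assms(4) by auto
  have g_le: "g j \<le> \<mu>" if "j \<in> {1..m}" for j unfolding \<mu>_def using that by auto
  have \<mu>2: "\<mu>\<^sup>2 < 1" using \<mu> by (simp add: power_less_one_iff)
  have \<gamma>2: "\<gamma>\<^sup>2 = \<mu>\<^sup>2 + (1 - \<mu>\<^sup>2) * ((1 + c\<^sub>F)\<^sup>2 / 4)" and \<gamma>0: "0 \<le> \<gamma>"
    unfolding \<gamma>_def using \<mu>2 by simp_all
  \<comment> \<open>Now \<open>c\<^sub>F < 1\<close> makes \<open>\<gamma>\<^sup>2\<close> a convex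
    combination of 1 and a number below 1, with positive weight \<open>1 - \<mu>\<^sup>2\<close> on
    the latter.\<close>
  have "(1 + c\<^sub>F)\<^sup>2 < 2\<^sup>2" using c by (intro power_strict_mono) auto
  then have "(1 - \<mu>\<^sup>2) * ((1 + c\<^sub>F)\<^sup>2 / 4) < (1 - \<mu>\<^sup>2) * 1"
    using \<mu>2 by (intro mult_strict_left_mono) auto
  then have \<gamma>1: "\<gamma> < 1" unfolding \<gamma>_def by simp
  have c_le: "c\<^sub>F\<^sup>2 \<le> (1 + c\<^sub>F)\<^sup>2 / 4"
    using power_mono[of "c\<^sub>F" "(1 + c\<^sub>F) / 2" 2] c by (simp add: power_divide)

  have contract: "norm (T x - P x) \<le> \<gamma> * norm (x - P x)" for x
  proof -
    have orth: "x - P x \<in> (\<Inter>i\<in>{1..m}. V i)\<^sup>\<bottom>"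
      unfolding mem_orthogonal_comp
    proof
      fix v assume "v \<in> (\<Inter>i\<in>{1..m}. V i)"
      then have "P x + v \<in> F" by (auto simp: F_def intro: Vmem[THEN iffD1])
      then show "(x - P x) \<bullet> v = 0"
        unfolding P_def using metric_proj_orthogonal[OF F(1-3) _ P_mem[of x], of "P x + v" x]
        by (simp add: P_def)
    qed
    \<comment> \<open>As the weights sum to 1, \<open>P x\<close> can be distributed over the
      average.\<close>
    have "T x - P x = (\<Sum>j\<in>{1..m}. \<omega> j *\<^sub>R (G j x - P x))"
      using assms(3) by (simp add: T_def scaleR_diff_right sum_subtractf flip: scaleR_sum_left)
    then have "(norm (T x - P x))\<^sup>2 \<le> (\<Sum>j\<in>{1..m}. \<omega> j * (norm (G j x - P x))\<^sup>2)"
      using norm_convex_combination_sq_le[OF less_imp_le[OF w] assms(3)] by simp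
    also have "\<dots> \<le> (\<Sum>j\<in>{1..m}. \<omega> j * (\<mu>\<^sup>2 * (norm (x - P x))\<^sup>2
        + (1 - \<mu>\<^sup>2) * (norm (metric_proj (V j) (x - P x)))\<^sup>2))"
    proof (intro sum_mono mult_left_mono)
      fix j assume j: "j \<in> {1..m}"
      show "(norm (G j x - P x))\<^sup>2 \<le> \<mu>\<^sup>2 * (norm (x - P x))\<^sup>2
          + (1 - \<mu>\<^sup>2) * (norm (metric_proj (V j) (x - P x)))\<^sup>2"
        unfolding Vproj[OF j]
        using BAM_affine_norm_le[OF assms(5)[OF j] _ P_mem_Fix[OF j] g_le[OF j]] assms(6)[OF j] \<mu>
        by simp
    qed (use w less_imp_le in blast)
    also have "\<dots> = (\<Sum>j\<in>{1..m}. \<omega> j * (\<mu>\<^sup>2 * (norm (x - P x))\<^sup>2)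
        + (1 - \<mu>\<^sup>2) * (\<omega> j * (norm (metric_proj (V j) (x - P x)))\<^sup>2))"
      by (intro sum.cong) (auto simp: algebra_simps)
    also have "\<dots> = \<mu>\<^sup>2 * (norm (x - P x))\<^sup>2
        + (1 - \<mu>\<^sup>2) * (\<Sum>j\<in>{1..m}. \<omega> j * (norm (metric_proj (V j) (x - P x)))\<^sup>2)"
      unfolding sum.distrib sum_distrib_right[symmetric] assms(3) sum_distrib_left[symmetric] by simp
    also have "\<dots> \<le> \<mu>\<^sup>2 * (norm (x - P x))\<^sup>2
        + (1 - \<mu>\<^sup>2) * ((1 + c\<^sub>F)\<^sup>2 / 4 * (norm (x - P x))\<^sup>2)"
      using order_trans[OF sum_proj_le[OF orth] mult_right_mono[OF c_le]] \<mu>2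
      by (intro add_left_mono mult_left_mono) auto
    also have "\<dots> = (\<gamma> * norm (x - P x))\<^sup>2"
      unfolding power_mult_distrib \<gamma>2 by (simp add: algebra_simps)
    finally show ?thesis by (rule power2_le_imp_le) (simp add: \<gamma>0)
  qed
  have Fix_T: "Fix T = F"
  proof
    show "F \<subseteq> Fix T"
    proof
      fix x assume "x \<in> F"
      then have "T x = (\<Sum>j\<in>{1..m}. \<omega> j *\<^sub>R x)"
        unfolding T_def by (intro sum.cong) (auto simp: F_def Fix_def)
      then show "x \<in> Fix T" using assms(3) by (simp add: Fix_def flip: scaleR_sum_left)
    qed
    show "Fix T \<subseteq> F"
    proof
      \<comment> \<open>The contraction estimate leaves a fixed point no positive distance to
        \<open>P x\<close>, because \<open>\<gamma> < 1\<close>.\<close>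
      fix x assume "x \<in> Fix T"
      then have "norm (x - P x) \<le> \<gamma> * norm (x - P x)" using contract[of x] by (simp add: Fix_def)
      then have "(1 - \<gamma>) * norm (x - P x) \<le> 0" by (simp add: algebra_simps)
      then have "x = P x" using \<gamma>1 by (simp add: mult_le_0_iff)
      then show "x \<in> F" using P_mem[of x] by simp
    qed
  qed
  \<comment> \<open>\<open>T x - x\<close> averages displacements that are each orthogonal to the
    directions of \<open>F\<close>, so moving from \<open>x\<close> to \<open>T x\<close> keeps the
    projection.\<close>
  have P_T: "P (T x) = P x" for x
    unfolding P_def
  proof (rule metric_proj_eqI[OF F(2,4)])
    show "metric_proj F x \<in> F" using P_mem[of x] by (simp add: P_def)
    fix y assume y: "y \<in> F"
    have "T x - x = (\<Sum>j\<in>{1..m}. \<omega> j *\<^sub>R (G j x - x))"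
      using assms(3) by (simp add: T_def scaleR_diff_right sum_subtractf flip: scaleR_sum_left)
    moreover have "(G j x - x) \<bullet> (y - P x) = 0" if "j \<in> {1..m}" for j
      using BAM_affine_orthogonal[OF assms(5)[OF that] _ _ P_mem_Fix[OF that]] assms(6)[OF that] y that
      by (auto simp: F_def)
    ultimately have "(T x - x) \<bullet> (y - P x) = 0" by (simp add: inner_sum_left)
    moreover have "(x - P x) \<bullet> (y - P x) = 0"
      using metric_proj_orthogonal[OF F(1-3) y P_mem] by (simp add: P_def)
    ultimately show "(T x - metric_proj F x) \<bullet> (y - metric_proj F x) = 0"
      by (simp add: P_def inner_diff_left)
  qed
  have BAM_T: "BAM \<gamma> T"
    unfolding BAM_def Fix_T P_def[symmetric]
    by (intro conjI allI \<gamma>0 \<gamma>1 F P_T contract)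
  have "norm ((T ^^ k) x - metric_proj F x) \<le> \<gamma> ^ k * norm (x - metric_proj F x)" for x k
    using BAM_funpow_norm_le[OF BAM_T, of k x] unfolding Fix_T .
  then show ?thesis
    unfolding F_def[symmetric] using Fix_T F BAM_T by simp
qed

end
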